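(* Let $a,b,c,d,e\in\mathbb{N}$ be such that $a\mid d$, $b\mid d$, $c\mid d$ and $\gcd(a,b,c)=1$. Let $F$ be the set of fundamental solutions of the diophantine equation $$ax^2+by^2+cz^2=dxyz+e.$$ If $F\neq\emptyset$, then $1\le e\le 4$.
   Context: $\mathbb{N}$ denotes the positive integers. A fundamental solution of $ax^2+by^2+cz^2=dxyz+e$ is a solution $(x,y,z)\in\mathbb{N}^3$ of this equation satisfying $$1\le x\le \frac{d}{2a}yz,\qquad 1\le y\le\frac{d}{2b}xz,\qquad 1\le z\le\frac{d}{2c}xy.$$ *)

theory Defs
  imports Complex_Main
begin

definition is_solution ::
  "nat \<Rightarrow> nat \<Rightarrow> nat \<Rightarrow> nat \<Rightarrow> nat \<Rightarrow> nat \<times> nat \<times> nat \<Rightarrow> bool" where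
  "is_solution a b c d e = (\<lambda>(x, y, z).
     0 < x \<and> 0 < y \<and> 0 < z \<and>
     a * x ^ 2 + b * y ^ 2 + c * z ^ 2 = d * x * y * z + e)"

text \<open>The bounds are inequalities between real numbers: the quotients are not
  rounded.\<close>

definition fundamental_solutions ::
  "nat \<Rightarrow> nat \<Rightarrow> nat \<Rightarrow> nat \<Rightarrow> nat \<Rightarrow> (nat \<times> nat \<times> nat) set" where
  "fundamental_solutions a b c d e = {(x, y, z).
     is_solution a b c d e (x, y, z) \<and>
     1 \<le> x \<and> real x \<le> real d / (2 * real a) * real y * real z \<and>
     1 \<le> y \<and> real y \<le> real d / (2 * real b) * real x * real z \<and>
     1 \<le> z \<and> real z \<le> real d / (2 * real c) * real x * real y}"

end

theory Submission
  imports Defs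
begin

text \<open>Put \<open>X = d x / sqrt (b c)\<close>, \<open>Y = d y / sqrt (a c)\<close>, \<open>Z = d z / sqrt (a b)\<close>. The equation
  becomes \<open>X\<^sup>2 + Y\<^sup>2 + Z\<^sup>2 - X Y Z = e d\<^sup>2 / (a b c)\<close> and the fundamental conditions become
  \<open>2 X \<le> Y Z\<close>, \<open>2 Y \<le> X Z\<close>, \<open>2 Z \<le> X Y\<close>, which force the left-hand side to be at most 4. On the
  other hand \<open>d\<^sup>2\<close> is divisible by each of \<open>b c\<close>, \<open>a c\<close>, \<open>a b\<close>, hence by \<open>a b c\<close> as
  \<open>gcd(a, b, c) = 1\<close>. So \<open>e \<le> e d\<^sup>2 / (a b c) \<le> 4\<close>.\<close>

text \<open>As a quadratic in \<open>z\<close>, the form minus 4 has discriminant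
  \<open>(x^2 - 4) * (y^2 - 4)\<close>. So the bound amounts to
  \<open>(x * y - 2 * z)^2 \<le> (x^2 - 4) * (y^2 - 4)\<close>.\<close>

lemma markoff_form_le_4_aux:
  fixes x y z :: real
  assumes "0 < x" "0 < y" "x \<le> z" "y \<le> z" "2 * z \<le> x * y"
  shows "x\<^sup>2 + y\<^sup>2 + z\<^sup>2 - x * y * z \<le> 4"
proof -
  have "2 * y \<le> x * y" "2 * x \<le> y * x"
    using assms by (auto simp only: mult.commute[of y])
  hence "2 \<le> x" "2 \<le> y"
    using assms(1,2) by (simp_all only: mult_le_cancel_right_pos)
  \<comment> \<open>The two copies of \<open>x * y - 2 * z\<close> are bounded differently, one by
    \<open>y \<le> z\<close> and the other by \<open>x \<le> z\<close>, so that both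
    \<open>x - 2\<close> and \<open>y - 2\<close> appear as factors.\<close>
  have "(x * y - 2 * z)\<^sup>2 \<le> ((x - 2) * y) * ((y - 2) * x)"
    unfolding power2_eq_square
    using assms \<open>2 \<le> x\<close> by (intro mult_mono) (auto simp: algebra_simps)
  also have "\<dots> = ((x - 2) * (y - 2)) * (x * y)"
    by (simp add: algebra_simps)
  also have "\<dots> \<le> ((x - 2) * (y - 2)) * ((x + 2) * (y + 2))"
    using \<open>2 \<le> x\<close> \<open>2 \<le> y\<close> by (intro mult_left_mono mult_mono) auto
  also have "\<dots> = (x * y - 2 * z)\<^sup>2 - 4 * (x\<^sup>2 + y\<^sup>2 + z\<^sup>2 - x * y * z - 4)"
    by (simp add: power2_eq_square algebra_simps)
  finally show ?thesis by simp
qed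

text \<open>By symmetry the largest variable can be moved to the last place.\<close>

lemma markoff_form_le_4:
  fixes x y z :: real
  assumes "0 < x" "0 < y" "0 < z" "2 * x \<le> y * z" "2 * y \<le> x * z" "2 * z \<le> x * y"
  shows "x\<^sup>2 + y\<^sup>2 + z\<^sup>2 - x * y * z \<le> 4"
proof -
  consider "x \<le> z" "y \<le> z" | "x \<le> y" "z \<le> y" | "y \<le> x" "z \<le> x"
    by linarith
  thus ?thesis
    using markoff_form_le_4_aux[of x y z] markoff_form_le_4_aux[of x z y]
      markoff_form_le_4_aux[of y z x] assms
    by cases (auto simp: algebra_simps)
qed

text \<open>Since \<open>b * c\<close>, \<open>a * c\<close> and \<open>a * b\<close> divide
  \<open>d^2\<close>, the product \<open>a * b * c\<close> divides \<open>d^2 * a\<close>,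
  \<open>d^2 * b\<close> and \<open>d^2 * c\<close>, hence also their gcd, which is
  \<open>d^2\<close> up to a unit.\<close>

lemma mult_dvd_power2_if_gcd3_eq_1:
  fixes a b c d :: "'a :: semiring_gcd"
  assumes "a dvd d" "b dvd d" "c dvd d" "gcd a (gcd b c) = 1"
  shows "a * b * c dvd d\<^sup>2"
proof -
  have "a * b * c dvd d\<^sup>2 * a" "a * b * c dvd d\<^sup>2 * b" "a * b * c dvd d\<^sup>2 * c"
    using mult_dvd_mono[OF mult_dvd_mono[OF assms(2,3)] dvd_refl[of a]]
      mult_dvd_mono[OF mult_dvd_mono[OF assms(1,3)] dvd_refl[of b]]
      mult_dvd_mono[OF mult_dvd_mono[OF assms(1,2)] dvd_refl[of c]]
    by (simp_all add: power2_eq_square ac_simps)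
  hence "a * b * c dvd gcd (d\<^sup>2 * a) (gcd (d\<^sup>2 * b) (d\<^sup>2 * c))"
    by (intro gcd_greatest)
  also have "\<dots> = normalize (d\<^sup>2 * gcd a (gcd b c))"
    by (simp add: gcd_mult_left)
  finally show ?thesis
    using assms(4) by simp
qed

lemma fundamental_solution_imp_le:
  assumes "0 < a" "0 < b" "0 < c" "0 < d" and "(x, y, z) \<in> fundamental_solutions a b c d e"
  shows "e * d\<^sup>2 \<le> 4 * (a * b * c)"
proof -
  define X Y Z where "X = d * x / (sqrt b * sqrt c)" and "Y = d * y / (sqrt a * sqrt c)"
    and "Z = d * z / (sqrt a * sqrt b)"
  note XYZ = X_def Y_def Z_def
  note sol = assms(5)[unfolded fundamental_solutions_def is_solution_def]
  have le: "2 * a * x \<le> real d * y * z" "2 * b * y \<le> real d * x * z" "2 * c * z \<le> real d * x * y"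
    using sol assms by (auto simp: field_simps)
  have "real (a * x\<^sup>2 + b * y\<^sup>2 + c * z\<^sup>2) = real (d * x * y * z + e)"
    using sol by simp
  hence eq: "real e = a * (real x)\<^sup>2 + b * (real y)\<^sup>2 + c * (real z)\<^sup>2 - real d * x * y * z"
    by simp
  have sq: "sqrt a * sqrt a = a" "sqrt b * sqrt b = b" "sqrt c * sqrt c = c"
    by simp_all
  \<comment> \<open>Each product is a nonnegative factor times the right-hand side of an inequality
    in \<open>le\<close>; the same factor turns the left-hand side into \<open>2 * X\<close>,
    \<open>2 * Y\<close> or \<open>2 * Z\<close>.\<close>
  have YZ: "Y * Z = d / (a * (sqrt b * sqrt c)) * (real d * y * z)"
    and XZ: "X * Z = d / (b * (sqrt a * sqrt c)) * (real d * x * z)"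
    and XY: "X * Y = d / (c * (sqrt a * sqrt b)) * (real d * x * y)"
    unfolding XYZ using sq by (simp_all add: ac_simps)
  have "X\<^sup>2 + Y\<^sup>2 + Z\<^sup>2 - X * Y * Z \<le> 4"
  proof (rule markoff_form_le_4)
    show "0 < X" "0 < Y" "0 < Z"
      using assms sol by (auto simp: XYZ)
    have "2 * X = d / (a * (sqrt b * sqrt c)) * (2 * a * x)"
      using assms by (simp add: XYZ)
    also have "\<dots> \<le> Y * Z"
      unfolding YZ using le by (intro mult_left_mono) auto
    finally show "2 * X \<le> Y * Z" .
    have "2 * Y = d / (b * (sqrt a * sqrt c)) * (2 * b * y)"
      using assms by (simp add: XYZ)
    also have "\<dots> \<le> X * Z"
      unfolding XZ using le by (intro mult_left_mono) auto
    finally show "2 * Y \<le> X * Z" .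
    have "2 * Z = d / (c * (sqrt a * sqrt b)) * (2 * c * z)"
      using assms by (simp add: XYZ)
    also have "\<dots> \<le> X * Y"
      unfolding XY using le by (intro mult_left_mono) auto
    finally show "2 * Z \<le> X * Y" .
  qed
  moreover have "X * Y * Z = real d ^ 3 * x * y * z / (real a * b * c)"
    unfolding XY unfolding XYZ using assms by (simp add: field_simps power3_eq_cube)
  moreover have "X\<^sup>2 = (real d)\<^sup>2 * (real x)\<^sup>2 / (real b * c)" "Y\<^sup>2 = (real d)\<^sup>2 * (real y)\<^sup>2 / (real a * c)"
    "Z\<^sup>2 = (real d)\<^sup>2 * (real z)\<^sup>2 / (real a * b)"
    by (simp_all add: XYZ power_divide power_mult_distrib)
  \<comment> \<open>This is the original equation multiplied by \<open>d^2 / (a * b * c)\<close>;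
    its right-hand side is the form in \<open>X\<close>, \<open>Y\<close>, \<open>Z\<close>.\<close>
  moreover have "e * (real d)\<^sup>2 / (real a * b * c) = (real d)\<^sup>2 * (real x)\<^sup>2 / (real b * c)
      + (real d)\<^sup>2 * (real y)\<^sup>2 / (real a * c) + (real d)\<^sup>2 * (real z)\<^sup>2 / (real a * b)
      - real d ^ 3 * x * y * z / (real a * b * c)"
    using assms(1-4) unfolding eq by (simp add: field_simps power2_eq_square power3_eq_cube)
  ultimately have "e * (real d)\<^sup>2 / (real a * b * c) \<le> 4"
    by simp
  hence "real (e * d\<^sup>2) \<le> real (4 * (a * b * c))"
    using assms by (simp add: field_simps)
  thus ?thesis
    by (simp only: of_nat_le_iff)
qed

theorem theorem4p1:
  fixes a b c d e :: nat and F :: "(nat \<times> nat \<times> nat) set"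
  assumes "0 < a" and "0 < b" and "0 < c" and "0 < d" and "0 < e"
    and "a dvd d" and "b dvd d" and "c dvd d"
    and "gcd a (gcd b c) = 1"
    and "F = fundamental_solutions a b c d e"
    and "F \<noteq> {}"
  shows "1 \<le> e \<and> e \<le> 4"
proof -
  obtain x y z where "(x, y, z) \<in> fundamental_solutions a b c d e"
    using assms by auto
  hence "e * d\<^sup>2 \<le> 4 * (a * b * c)"
    using assms by (intro fundamental_solution_imp_le)
  also have "a * b * c \<le> d\<^sup>2"
    using mult_dvd_power2_if_gcd3_eq_1[OF assms(6-9)] assms(4) by (intro dvd_imp_le) auto
  finally have "e * d\<^sup>2 \<le> 4 * d\<^sup>2"
    by simp
  thus ?thesis
    using assms by simp
qed

end
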